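(* Let $(\xi_n)_{n=0}^\infty$ be a nonhomogeneous Markov chain on a probability space $(\Omega,\mathcal{F},\mathbb{P})$ with values in the finite state space $\mathbf{X}=\{1,2,\ldots,b\}$, with initial distribution $(\mu_0(1),\ldots,\mu_0(b))$ and transition matrices $P_n=(p_n(i,j))_{b\times b}$, $n\ge 1$, where $p_n(i,j)=\mathbb{P}(\xi_n=j\mid \xi_{n-1}=i)$. Let $(a_n)_{n=0}^\infty$ and $(\phi(n))_{n=0}^\infty$ be two sequences of nonnegative integers such that $\phi(n)\to\infty$ as $n\to\infty$, and suppose that for every $\varepsilon>0$ $$\sum_{n=1}^\infty \exp[-\varepsilon\phi(n)]<\infty .$$ Let $P=(p(i,j))_{b\times b}$ be an irreducible transition matrix on $\mathbf{X}$, and suppose that $$\lim_{n\to\infty}\frac{1}{\phi(n)}\sum_{k=a_n+1}^{a_n+\phi(n)}|p_k(i,j)-p(i,j)|=0\qquad\text{for all } i,j\in\mathbf{X}.$$ Let $(\pi_1,\ldots,\pi_b)$ be the unique stationary distribution determined by $P$. Then, with $S_{a_n,\phi(n)}(i;\omega)$, $S_{a_n,\phi(n)}(i,j;\omega)$ and $f_{a_n,\phi(n)}(\omega)$ as defined in the context: (i) $\displaystyle \lim_{n\to\infty}\frac{1}{\phi(n)}S_{a_n,\phi(n)}(i;\omega)=\pi_i$ almost everywhere, for all $i\in\mathbf{X}$; (ii) $\displaystyle \lim_{n\to\infty}\frac{1}{\phi(n)}S_{a_n,\phi(n)}(i,j;\omega)=\pi_i\,p(i,j)$ almost everywhere, for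 all $i,j\in\mathbf{X}$; (iii) $\displaystyle \lim_{n\to\infty}f_{a_n,\phi(n)}(\omega)=-\sum_{i=1}^b\sum_{j=1}^b\pi_i\,p(i,j)\log p(i,j)$ almost everywhere.
   Context: $\log$ is the natural logarithm, with the usual convention $0\log 0=0$. $\mathbf{1}_{\{i\}}(\cdot)$ is the indicator function of $\{i\}$. The ratios with denominator $\phi(n)$ are considered for those $n$ with $\phi(n)\ge 1$ (all sufficiently large $n$). For nonnegative integers $m,n$ and $i,j\in\mathbf{X}$, $$S_{m,n}(j;\omega)=\sum_{k=m}^{m+n-1}\mathbf{1}_{\{j\}}(\xi_k)$$ is the number of occurrences of $j$ in the segment $\xi_m,\ldots,\xi_{m+n-1}$, and $$S_{m,n}(i,j;\omega)=\sum_{k=m}^{m+n-1}\mathbf{1}_{\{i\}}(\xi_k)\mathbf{1}_{\{j\}}(\xi_{k+1})$$ is the number of occurrences of the pair $(i,j)$ among $(\xi_m,\xi_{m+1}),\ldots,(\xi_{m+n-1},\xi_{m+n})$. The generalized entropy density of $(\xi_{a_n},\ldots,\xi_{a_n+\phi(n)})$ for the Markov chain is $$f_{a_n,\phi(n)}(\omega)=-\frac{1}{\phi(n)}\Big\{\log\mu_{a_n}(\xi_{a_n})+\sum_{k=a_n+1}^{a_n+\phi(n)}\log p_k(\xi_{k-1},\xi_k)\Big\},$$ where $\mu_{a_n}(x)=\mathbb{P}(\xi_{a_n}=x)$ is the distribution of $\xi_{a_n}$. *)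

theory Defs
  imports "HOL-Probability.Probability"
begin

text \<open>
  Matrices over the state space \<open>{1..b}\<close> are functions \<open>nat \<Rightarrow> nat \<Rightarrow> real\<close>; only their values on
  \<open>{1..b} \<times> {1..b}\<close> are relevant.
\<close>

definition transition_matrix :: "nat \<Rightarrow> (nat \<Rightarrow> nat \<Rightarrow> real) \<Rightarrow> bool" where
  "transition_matrix b P \<longleftrightarrow>
     (\<forall>i\<in>{1..b}. (\<forall>j\<in>{1..b}. 0 \<le> P i j) \<and> (\<Sum>j\<in>{1..b}. P i j) = 1)"

primrec matrix_power :: "nat \<Rightarrow> (nat \<Rightarrow> nat \<Rightarrow> real) \<Rightarrow> nat \<Rightarrow> nat \<Rightarrow> nat \<Rightarrow> real" where
  "matrix_power b P 0 = (\<lambda>i j. if i = j then 1 else 0)"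
| "matrix_power b P (Suc n) = (\<lambda>i j. \<Sum>k\<in>{1..b}. matrix_power b P n i k * P k j)"

definition irreducible_matrix :: "nat \<Rightarrow> (nat \<Rightarrow> nat \<Rightarrow> real) \<Rightarrow> bool" where
  "irreducible_matrix b P \<longleftrightarrow>
     (\<forall>i\<in>{1..b}. \<forall>j\<in>{1..b}. \<exists>n\<ge>1. 0 < matrix_power b P n i j)"

definition stationary_distribution :: "nat \<Rightarrow> (nat \<Rightarrow> nat \<Rightarrow> real) \<Rightarrow> (nat \<Rightarrow> real) \<Rightarrow> bool" where
  "stationary_distribution b P \<pi> \<longleftrightarrow>
     (\<forall>i\<in>{1..b}. 0 \<le> \<pi> i) \<and> (\<Sum>i\<in>{1..b}. \<pi> i) = 1 \<and>
     (\<forall>j\<in>{1..b}. (\<Sum>i\<in>{1..b}. \<pi> i * P i j) = \<pi> j)"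

text \<open>
  Conditional probabilities are prescribed only where the conditioning event has positive
  probability. On states that \<open>\<xi> n\<close> does not charge, the row of \<open>p (Suc n)\<close> is thus an arbitrary
  probability vector. The matrix \<open>p 0\<close> plays no role.
\<close>

locale nonhomogeneous_markov_chain = prob_space M
  for M :: "'a measure" +
  fixes b :: nat
    and \<xi> :: "nat \<Rightarrow> 'a \<Rightarrow> nat"
    and \<mu>0 :: "nat \<Rightarrow> real"
    and p :: "nat \<Rightarrow> nat \<Rightarrow> nat \<Rightarrow> real"
  assumes random_variable: "\<And>n. \<xi> n \<in> measurable M (count_space {1..b})"
    and initial_distribution:
      "\<And>i. i \<in> {1..b} \<Longrightarrow> \<P>(\<omega> in M. \<xi> 0 \<omega> = i) = \<mu>0 i"
    and transition_matrices: "\<And>n. 1 \<le> n \<Longrightarrow> transition_matrix b (p n)"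
    and transition_probability:
      "\<And>n i j. i \<in> {1..b} \<Longrightarrow> j \<in> {1..b} \<Longrightarrow> 0 < \<P>(\<omega> in M. \<xi> n \<omega> = i) \<Longrightarrow>
         \<P>(\<omega> in M. \<xi> (Suc n) \<omega> = j \<bar> \<xi> n \<omega> = i) = p (Suc n) i j"
    and markov_property:
      "\<And>n x j. j \<in> {1..b} \<Longrightarrow> 0 < \<P>(\<omega> in M. \<forall>k\<le>n. \<xi> k \<omega> = x k) \<Longrightarrow>
         \<P>(\<omega> in M. \<xi> (Suc n) \<omega> = j \<bar> \<forall>k\<le>n. \<xi> k \<omega> = x k)
           = \<P>(\<omega> in M. \<xi> (Suc n) \<omega> = j \<bar> \<xi> n \<omega> = x n)"

definition state_count :: "(nat \<Rightarrow> 'a \<Rightarrow> nat) \<Rightarrow> nat \<Rightarrow> nat \<Rightarrow> nat \<Rightarrow> 'a \<Rightarrow> real" where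
  "state_count \<xi> m n j \<omega> = (\<Sum>k\<in>{m..<m + n}. indicator {j} (\<xi> k \<omega>))"

definition pair_count :: "(nat \<Rightarrow> 'a \<Rightarrow> nat) \<Rightarrow> nat \<Rightarrow> nat \<Rightarrow> nat \<Rightarrow> nat \<Rightarrow> 'a \<Rightarrow> real" where
  "pair_count \<xi> m n i j \<omega> =
     (\<Sum>k\<in>{m..<m + n}. indicator {i} (\<xi> k \<omega>) * indicator {j} (\<xi> (k + 1) \<omega>))"

text \<open>
  The first logarithm is that of the distribution of \<open>\<xi> m\<close>, evaluated at the observed state \<open>\<xi> m \<omega>\<close>.
  Since \<open>ln 0 = 0\<close> in HOL, the convention \<open>0 log 0 = 0\<close> holds, and arguments \<open>0\<close> of \<open>ln\<close> below
  occur only on a null set of \<open>\<omega>\<close>.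
\<close>

definition segment_entropy_density ::
  "'a measure \<Rightarrow> (nat \<Rightarrow> 'a \<Rightarrow> nat) \<Rightarrow> (nat \<Rightarrow> nat \<Rightarrow> nat \<Rightarrow> real) \<Rightarrow> nat \<Rightarrow> nat \<Rightarrow> 'a \<Rightarrow> real" where
  "segment_entropy_density M \<xi> p m n \<omega> =
     - (1 / real n) *
       (ln \<P>(\<omega>' in M. \<xi> m \<omega>' = \<xi> m \<omega>) + (\<Sum>k\<in>{m + 1..m + n}. ln (p k (\<xi> (k - 1) \<omega>) (\<xi> k \<omega>))))"

end

theory Submission
  imports Defs
begin

text \<open>
  For functions \<open>g\<^sub>k\<close> with \<open>\<Sum>\<^sub>j p\<^sub>k(i,j) exp \<bar>g\<^sub>k(i,j)\<bar> \<le> K\<close>, the exponentials of the partial sums of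
  \<open>g\<^sub>k(\<xi>\<^sub>k\<^sub>-\<^sub>1,\<xi>\<^sub>k) - \<Sum>\<^sub>j p\<^sub>k(\<xi>\<^sub>k\<^sub>-\<^sub>1,j) g\<^sub>k(\<xi>\<^sub>k\<^sub>-\<^sub>1,j)\<close>, scaled by \<open>s\<close> and corrected by \<open>exp (- s\<^sup>2 K n)\<close>, form a
  supermartingale. A Chernoff bound exponential in \<open>\<phi>(n)\<close> and the Borel--Cantelli lemma then show
  that the window averages of these differences vanish almost everywhere. The unbounded choice
  \<open>g\<^sub>k = log p\<^sub>k\<close> is covered with \<open>K = b\<close>, since \<open>p exp \<bar>log p\<bar> \<le> 1\<close>. Averaged convergence of \<open>p\<^sub>k\<close> to \<open>P\<close>
  replaces \<open>p\<^sub>k\<close> by \<open>P\<close> in the compensators. With \<open>g\<close> the indicator of a pair, this makes the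
  state frequencies asymptotically \<open>P\<close>-invariant, so by compactness and uniqueness of the
  stationary distribution they converge to \<open>\<pi>\<close>.
\<close>

subsection \<open>Analytic estimates\<close>

text \<open>Termwise comparison of the Taylor series from second order on, using
  \<open>\<bar>s\<bar> ^ (n + 2) \<le> s\<^sup>2\<close>. The factor
  \<open>exp \<bar>x\<bar>\<close> is free of \<open>s\<close>, so one exponential moment controls
  all small \<open>s\<close> and no bound on \<open>x\<close> is required.\<close>

lemma exp_mult_le_quadratic:
  fixes s x :: real
  assumes "\<bar>s\<bar> \<le> 1"
  shows "exp (s * x) \<le> 1 + s * x + s\<^sup>2 * exp \<bar>x\<bar>"
proof -
  define tail where "tail = (\<lambda>y::real. \<lambda>n. y ^ (n + 2) /\<^sub>R fact (n + 2))"
  have tail: "tail y sums (exp y - 1 - y)" for y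
  proof -
    have "(\<lambda>n. y ^ (n + 2) /\<^sub>R fact (n + 2)) sums (exp y - (\<Sum>i<2. y ^ i /\<^sub>R fact i))"
      by (rule sums_split_initial_segment[OF exp_converges])
    then show ?thesis by (simp add: tail_def numeral_2_eq_2 algebra_simps)
  qed
  have "exp (s * x) - 1 - s * x \<le> s\<^sup>2 * (exp \<bar>x\<bar> - 1 - \<bar>x\<bar>)"
  proof (rule sums_le[OF _ tail sums_mult[OF tail]])
    fix n
    have "\<bar>s\<bar> ^ n * s\<^sup>2 \<le> 1 * s\<^sup>2"
      by (rule mult_right_mono) (use assms in \<open>auto intro: power_le_one\<close>)
    then have "\<bar>s\<bar> ^ (n + 2) \<le> s\<^sup>2" by (simp only: power_add power2_abs mult_1)
    then have "\<bar>s\<bar> ^ (n + 2) * \<bar>x\<bar> ^ (n + 2) \<le> s\<^sup>2 * \<bar>x\<bar> ^ (n + 2)"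
      by (rule mult_right_mono) simp
    moreover have "(s * x) ^ (n + 2) \<le> \<bar>s\<bar> ^ (n + 2) * \<bar>x\<bar> ^ (n + 2)"
      by (metis abs_ge_self abs_mult power_abs power_mult_distrib)
    ultimately have "(s * x) ^ (n + 2) \<le> s\<^sup>2 * \<bar>x\<bar> ^ (n + 2)" by linarith
    then have "(s * x) ^ (n + 2) / fact (n + 2) \<le> s\<^sup>2 * \<bar>x\<bar> ^ (n + 2) / fact (n + 2)"
      by (rule divide_right_mono) simp
    then show "tail (s * x) n \<le> s\<^sup>2 * tail \<bar>x\<bar> n"
      by (simp add: tail_def divide_inverse mult_ac)
  qed
  also have "\<dots> \<le> s\<^sup>2 * exp \<bar>x\<bar>"
    by (rule mult_left_mono) auto
  finally show ?thesis by simp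
qed

lemma continuous_on_mult_ln: "continuous_on {0..1} (\<lambda>x::real. x * ln x)"
proof (rule continuous_on_eq_continuous_within[THEN iffD2], rule ballI)
  fix x :: real assume x: "x \<in> {0..1}"
  show "continuous (at x within {0..1}) (\<lambda>x. x * ln x)"
  proof (cases "x = 0")
    case True
    \<comment> \<open>The value at 0 is 0, so continuity there is exactly this one-sided
      limit.\<close>
    have "((\<lambda>x::real. x * ln x) \<longlongrightarrow> 0) (at_right 0)"
      by real_asymp
    then have "((\<lambda>x::real. x * ln x) \<longlongrightarrow> 0) (at 0 within {0..1})"
      by (simp add: at_within_Icc_at_right)
    then show ?thesis using True by (simp add: continuous_within)
  next
    case False
    then show ?thesis using x by (intro continuous_intros) auto
  qed
qed

text \<open>Meant for \<open>x * ln x\<close>, which is not Lipschitz at 0. Close to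
  \<open>q\<close> continuity gives \<open>e / 2\<close>; away from \<open>q\<close> boundedness of
  \<open>F\<close> gives a multiple of the distance, whose window average vanishes.\<close>

lemma window_average_continuous:
  fixes x :: "nat \<Rightarrow> real" and a \<phi> :: "nat \<Rightarrow> nat" and F :: "real \<Rightarrow> real"
  assumes F: "continuous_on {0..1} F" and q: "q \<in> {0..1}" and x: "\<And>k. 1 \<le> k \<Longrightarrow> x k \<in> {0..1}"
    and lim: "(\<lambda>n. 1 / real (\<phi> n) * (\<Sum>k\<in>{a n + 1..a n + \<phi> n}. \<bar>x k - q\<bar>)) \<longlonglongrightarrow> 0"
  shows "(\<lambda>n. 1 / real (\<phi> n) * (\<Sum>k\<in>{a n + 1..a n + \<phi> n}. \<bar>F (x k) - F q\<bar>)) \<longlonglongrightarrow> 0"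
proof -
  have "bounded (F ` {0..1})"
    by (intro compact_imp_bounded compact_continuous_image F) auto
  then obtain B where B: "\<And>y. y \<in> {0..1} \<Longrightarrow> \<bar>F y\<bar> \<le> B"
    unfolding bounded_iff real_norm_def by blast
  have B0: "0 \<le> B" using B[OF q] by linarith
  show ?thesis
  proof (rule LIMSEQ_I)
    fix e :: real assume e: "0 < e"
    obtain d where d: "0 < d" "\<And>y. y \<in> {0..1} \<Longrightarrow> \<bar>y - q\<bar> < d \<Longrightarrow> \<bar>F y - F q\<bar> < e / 2"
      using F q e unfolding continuous_on_iff dist_real_def by (metis half_gt_zero)
    \<comment> \<open>At distance at least \<open>d\<close> from \<open>q\<close>, the term
      \<open>C * \<bar>y - q\<bar>\<close> exceeds the largest possible difference
      \<open>2 * B\<close>.\<close>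
    define C where "C = 2 * B / d"
    have pt: "\<bar>F y - F q\<bar> \<le> e / 2 + C * \<bar>y - q\<bar>" if y: "y \<in> {0..1}" for y
    proof (cases "\<bar>y - q\<bar> < d")
      case True
      then show ?thesis using d(2)[OF y] B0 d(1) by (simp add: C_def add_increasing2 less_imp_le)
    next
      case False
      have "2 * B = C * d" using d(1) by (simp add: C_def)
      also have "\<dots> \<le> C * \<bar>y - q\<bar>" using False B0 d(1) by (intro mult_left_mono) (auto simp: C_def)
      finally show ?thesis using B[OF y] B[OF q] e by linarith
    qed
    have "(\<lambda>n. C * (1 / real (\<phi> n) * (\<Sum>k\<in>{a n + 1..a n + \<phi> n}. \<bar>x k - q\<bar>))) \<longlonglongrightarrow> 0"
      using tendsto_mult_left[OF lim, of C] by simp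
    from LIMSEQ_D[OF this, of "e / 2"] e obtain N where
      N: "\<And>n. n \<ge> N \<Longrightarrow> norm (C * (1 / real (\<phi> n) * (\<Sum>k\<in>{a n + 1..a n + \<phi> n}. \<bar>x k - q\<bar>)) - 0) < e / 2"
      by (meson half_gt_zero)
    show "\<exists>N. \<forall>n\<ge>N. norm (1 / real (\<phi> n) * (\<Sum>k\<in>{a n + 1..a n + \<phi> n}. \<bar>F (x k) - F q\<bar>) - 0) < e"
    proof (intro exI allI impI)
      fix n assume n: "N \<le> n"
      let ?I = "{a n + 1..a n + \<phi> n}"
      have "1 / real (\<phi> n) * (\<Sum>k\<in>?I. \<bar>F (x k) - F q\<bar>)
        \<le> 1 / real (\<phi> n) * (\<Sum>k\<in>?I. e / 2 + C * \<bar>x k - q\<bar>)"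
        by (intro mult_left_mono sum_mono pt x) auto
      also have "\<dots> = 1 / real (\<phi> n) * (real (\<phi> n) * (e / 2))
          + C * (1 / real (\<phi> n) * (\<Sum>k\<in>?I. \<bar>x k - q\<bar>))"
        by (simp add: sum.distrib sum_distrib_left algebra_simps add_divide_distrib sum_divide_distrib)
      also have "\<dots> < e"
      proof -
        \<comment> \<open>Only an inequality: for \<open>\<phi> n = 0\<close> the left side is
          0.\<close>
        have "1 / real (\<phi> n) * (real (\<phi> n) * (e / 2)) \<le> e / 2" using e by simp
        then show ?thesis using N[OF n] unfolding real_norm_def by linarith
      qed
      finally show "norm (1 / real (\<phi> n) * (\<Sum>k\<in>?I. \<bar>F (x k) - F q\<bar>) - 0) < e"
        by (simp add: sum_nonneg abs_of_nonneg)
    qed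
  qed
qed

subsection \<open>Stationary distributions of irreducible matrices\<close>

lemma matrix_power_nonneg:
  assumes "transition_matrix b P" "i \<in> {1..b}" "j \<in> {1..b}"
  shows "0 \<le> matrix_power b P n i j"
  using assms(3)
proof (induction n arbitrary: j)
  case (Suc n)
  then show ?case using assms(1,2)
    by (auto simp: transition_matrix_def intro!: sum_nonneg mult_nonneg_nonneg)
qed simp

lemma invariant_matrix_power:
  assumes "\<And>j. j \<in> {1..b} \<Longrightarrow> (\<Sum>i\<in>{1..b}. v i * P i j) = v j" "j \<in> {1..b}"
  shows "(\<Sum>i\<in>{1..b}. v i * matrix_power b P n i j) = v j"
  using assms(2)
proof (induction n arbitrary: j)
  case 0
  then show ?case by (simp add: if_distrib[of "\<lambda>x. _ * x"] cong: if_cong)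
next
  case (Suc n)
  have "(\<Sum>i\<in>{1..b}. v i * matrix_power b P (Suc n) i j)
      = (\<Sum>i\<in>{1..b}. \<Sum>k\<in>{1..b}. v i * matrix_power b P n i k * P k j)"
    by (simp add: sum_distrib_left mult.assoc)
  also have "\<dots> = (\<Sum>k\<in>{1..b}. (\<Sum>i\<in>{1..b}. v i * matrix_power b P n i k) * P k j)"
    by (subst sum.swap) (simp add: sum_distrib_right)
  also have "\<dots> = v j" using Suc assms(1) by simp
  finally show ?case .
qed

text \<open>The powers of \<open>P\<close> fix \<open>v\<close> too. By irreducibility some power
  has a positive entry from \<open>k\<close> to \<open>i\<close>, so mass at \<open>k\<close> would
  give mass at \<open>i\<close>.\<close>

lemma invariant_eq_0:
  assumes P: "transition_matrix b P" "irreducible_matrix b P"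
    and v: "\<And>j. j \<in> {1..b} \<Longrightarrow> (\<Sum>i\<in>{1..b}. v i * P i j) = v j"
      "\<And>i. i \<in> {1..b} \<Longrightarrow> 0 \<le> v i"
    and i: "i \<in> {1..b}" "v i = 0" and k: "k \<in> {1..b}"
  shows "v k = 0"
proof -
  obtain n where n: "0 < matrix_power b P n k i"
    using P(2) i k unfolding irreducible_matrix_def by blast
  have "(\<Sum>l\<in>{1..b}. v l * matrix_power b P n l i) = 0"
    using invariant_matrix_power[OF v(1) i(1)] i(2) by simp
  then have "v k * matrix_power b P n k i = 0"
    using k i v(2) matrix_power_nonneg[OF P(1) _ i(1)]
    by (subst (asm) sum_nonneg_eq_0_iff) auto
  then show ?thesis using n by simp
qed

lemma stationary_distribution_unique:
  assumes P: "transition_matrix b P" "irreducible_matrix b P"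
    and \<pi>: "stationary_distribution b P \<pi>" and \<mu>: "stationary_distribution b P \<mu>"
    and k: "k \<in> {1..b}"
  shows "\<mu> k = \<pi> k"
proof -
  have \<pi>_nonneg: "0 \<le> \<pi> j" and \<pi>_inv: "(\<Sum>i\<in>{1..b}. \<pi> i * P i j) = \<pi> j" if "j \<in> {1..b}" for j
    using \<pi> that by (auto simp: stationary_distribution_def)
  \<comment> \<open>Positivity lets the ratios \<mu> / \<pi> below be formed; a single zero of \<pi>
    would spread to all states, against total mass 1.\<close>
  have pos: "0 < \<pi> i" if "i \<in> {1..b}" for i
  proof (rule ccontr)
    assume "\<not> 0 < \<pi> i"
    then have "\<pi> i = 0" using \<pi>_nonneg[OF that] by linarith
    have "\<pi> l = 0" if "l \<in> {1..b}" for l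
      by (rule invariant_eq_0[OF P \<pi>_inv \<pi>_nonneg \<open>i \<in> {1..b}\<close> \<open>\<pi> i = 0\<close> that])
    then have "(\<Sum>i\<in>{1..b}. \<pi> i) = 0" by simp
    then show False using \<pi> by (simp add: stationary_distribution_def)
  qed
  \<comment> \<open>The largest multiple of \<open>\<pi>\<close> below \<open>\<mu>\<close>: the invariant difference vanishes at some state, hence everywhere.\<close>
  define c where "c = Min ((\<lambda>i. \<mu> i / \<pi> i) ` {1..b})"
  have "c \<in> (\<lambda>i. \<mu> i / \<pi> i) ` {1..b}"
    unfolding c_def using k by (intro Min_in) auto
  then obtain i where i: "i \<in> {1..b}" "c = \<mu> i / \<pi> i" by blast
  have c_le: "c \<le> \<mu> l / \<pi> l" if "l \<in> {1..b}" for l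
    unfolding c_def using that by (intro Min_le) auto
  have multiple: "\<mu> l - c * \<pi> l = 0" if l: "l \<in> {1..b}" for l
  proof (rule invariant_eq_0[OF P, of "\<lambda>l. \<mu> l - c * \<pi> l" i])
    show "(\<Sum>i\<in>{1..b}. (\<mu> i - c * \<pi> i) * P i j) = \<mu> j - c * \<pi> j" if "j \<in> {1..b}" for j
      using \<pi> \<mu> that
      by (simp add: stationary_distribution_def left_diff_distrib sum_subtractf mult.assoc
          flip: sum_distrib_left)
    show "0 \<le> \<mu> l - c * \<pi> l" if "l \<in> {1..b}" for l
      using c_le[OF that] pos[OF that] by (simp add: field_simps)
    show "\<mu> i - c * \<pi> i = 0" using i pos[OF i(1)] by simp
  qed (use i l in auto)
  \<comment> \<open>Both vectors have mass 1, so proportionality forces equality.\<close>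
  have "(\<Sum>l\<in>{1..b}. \<mu> l) = (\<Sum>l\<in>{1..b}. c * \<pi> l)"
    using multiple by (intro sum.cong) auto
  then have "c = 1"
    using \<pi> \<mu> by (simp add: stationary_distribution_def flip: sum_distrib_left)
  then show ?thesis using multiple[OF k] by simp
qed

text \<open>Bolzano-Weierstrass is applied to one index after another; subsequences keep the
  convergence already won.\<close>

lemma finite_family_convergent_subseq:
  fixes s :: "nat \<Rightarrow> 'i \<Rightarrow> real"
  assumes "finite I" "\<And>i. i \<in> I \<Longrightarrow> Bseq (\<lambda>n. s n i)"
  shows "\<exists>r. strict_mono r \<and> (\<forall>i\<in>I. convergent (\<lambda>n. s (r n) i))"
  using assms
proof (induction I rule: finite_induct)
  case empty
  show ?case by (intro exI[of _ id]) (auto simp: strict_mono_id)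
next
  case (insert i I)
  then obtain r where r: "strict_mono r" "\<And>j. j \<in> I \<Longrightarrow> convergent (\<lambda>n. s (r n) j)"
    by auto
  have "bounded (range (\<lambda>n. s (r n) i))"
    using insert.prems[of i] by (auto simp: Bseq_eq_bounded intro: bounded_subset)
  from bounded_imp_convergent_subsequence[OF this] obtain l t where
    t: "strict_mono t" "((\<lambda>n. s (r n) i) \<circ> t) \<longlonglongrightarrow> l" by blast
  have "convergent (\<lambda>n. s (r (t n)) j)" if "j \<in> insert i I" for j
  proof (cases "j = i")
    case True
    then show ?thesis using t(2) by (auto simp: o_def convergent_def)
  next
    case False
    then show ?thesis
      using convergent_subseq_convergent[OF r(2) t(1), of j] that by (simp add: o_def)
  qed
  then show ?case
    using strict_mono_o[OF r(1) t(1)] by (intro exI[of _ "r \<circ> t"]) (auto simp: o_def)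
qed

text \<open>If convergence failed, a subsequence staying \<open>e\<close> away from \<pi> would have
  a limit point \<open>L\<close>. Passing to the limit makes \<open>L\<close> stationary, hence
  equal to \<pi>. Aperiodicity of \<open>P\<close> is not assumed, so the argument avoids
  convergence of its powers.\<close>

lemma almost_invariant_tendsto_stationary:
  fixes s :: "nat \<Rightarrow> nat \<Rightarrow> real"
  assumes P: "transition_matrix b P" "irreducible_matrix b P"
    and \<pi>: "stationary_distribution b P \<pi>"
    and s0: "\<And>n i. 0 \<le> s n i" and s1: "\<forall>\<^sub>F n in sequentially. (\<Sum>i\<in>{1..b}. s n i) = 1"
    and inv: "\<And>j. j \<in> {1..b} \<Longrightarrow> (\<lambda>n. s n j - (\<Sum>i\<in>{1..b}. s n i * P i j)) \<longlonglongrightarrow> 0"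
    and i: "i \<in> {1..b}"
  shows "(\<lambda>n. s n i) \<longlonglongrightarrow> \<pi> i"
proof (rule ccontr)
  assume "\<not> ?thesis"
  then obtain e where e: "0 < e" "\<And>N. \<exists>n\<ge>N. e \<le> \<bar>s n i - \<pi> i\<bar>"
    unfolding LIMSEQ_iff by (force simp: not_less)
  obtain N where N: "\<And>n. n \<ge> N \<Longrightarrow> (\<Sum>i\<in>{1..b}. s n i) = 1"
    using s1 by (auto simp: eventually_sequentially)
  have inf: "infinite {n. N \<le> n \<and> e \<le> \<bar>s n i - \<pi> i\<bar>}"
    unfolding infinite_nat_iff_unbounded_le using e(2)
    by (metis (no_types, lifting) max.boundedE mem_Collect_eq)
  \<comment> \<open>Starting at \<open>N\<close> makes every selected vector a probability vector,
    hence bounded by 1.\<close>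
  define u where "u = enumerate {n. N \<le> n \<and> e \<le> \<bar>s n i - \<pi> i\<bar>}"
  have u: "strict_mono u" "\<And>n. N \<le> u n" "\<And>n. e \<le> \<bar>s (u n) i - \<pi> i\<bar>"
    using strict_mono_enumerate[OF inf] enumerate_in_set[OF inf] by (auto simp: u_def)
  have bd: "\<bar>s (u n) j\<bar> \<le> 1" if "j \<in> {1..b}" for n j
    using N[OF u(2)[of n]] member_le_sum[OF that, of "s (u n)"] s0 by auto
  have "\<exists>r. strict_mono r \<and> (\<forall>j\<in>{1..b}. convergent (\<lambda>n. s (u (r n)) j))"
    using bd by (intro finite_family_convergent_subseq) (auto intro!: BseqI'[of _ 1])
  then obtain r L where r: "strict_mono r" "\<And>j. j \<in> {1..b} \<Longrightarrow> (\<lambda>n. s (u (r n)) j) \<longlonglongrightarrow> L j"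
    unfolding convergent_def by metis
  have ur: "strict_mono (\<lambda>n. u (r n))"
    using strict_mono_o[OF u(1) r(1)] by (simp add: o_def)
  have "stationary_distribution b P L"
    unfolding stationary_distribution_def
  proof (intro conjI ballI)
    show "0 \<le> L j" if "j \<in> {1..b}" for j
      using r(2)[OF that] s0 by (intro LIMSEQ_le_const) auto
    have "(\<lambda>n. \<Sum>j\<in>{1..b}. s (u (r n)) j) \<longlonglongrightarrow> (\<Sum>j\<in>{1..b}. L j)"
      using r(2) by (intro tendsto_sum) auto
    moreover have "(\<lambda>n. \<Sum>j\<in>{1..b}. s (u (r n)) j) = (\<lambda>n. 1)"
      using N u(2) by auto
    ultimately show "(\<Sum>j\<in>{1..b}. L j) = 1"
      by (simp add: LIMSEQ_const_iff)
    show "(\<Sum>i\<in>{1..b}. L i * P i j) = L j" if j: "j \<in> {1..b}" for j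
    proof -
      have "(\<lambda>n. s (u (r n)) j - (\<Sum>i\<in>{1..b}. s (u (r n)) i * P i j))
          \<longlonglongrightarrow> L j - (\<Sum>i\<in>{1..b}. L i * P i j)"
        using r(2) j by (intro tendsto_intros) auto
      moreover have "(\<lambda>n. s (u (r n)) j - (\<Sum>i\<in>{1..b}. s (u (r n)) i * P i j)) \<longlonglongrightarrow> 0"
        using LIMSEQ_subseq_LIMSEQ[OF inv[OF j] ur] by (simp add: o_def)
      ultimately show ?thesis using LIMSEQ_unique by fastforce
    qed
  qed
  then have "L i = \<pi> i"
    by (rule stationary_distribution_unique[OF P \<pi> _ i])
  then have "(\<lambda>n. \<bar>s (u (r n)) i - \<pi> i\<bar>) \<longlonglongrightarrow> 0"
    using r(2)[OF i] by (auto simp: LIM_zero_iff intro!: tendsto_rabs_zero)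
  then have "e \<le> 0"
    using u(3) by (intro LIMSEQ_le_const) auto
  then show False using e(1) by simp
qed

subsection \<open>Limit theorems for averages over moving windows\<close>

context nonhomogeneous_markov_chain
begin

declare random_variable[measurable]

section \<open>One-step conditioning and the exponential supermartingale\<close>

lemma state_in: "\<omega> \<in> space M \<Longrightarrow> \<xi> n \<omega> \<in> {1..b}"
  using measurable_space[OF random_variable] by simp

text \<open>The product form also covers histories of probability 0, where the Markov assumption is
  silent: both sides then vanish. A history of positive probability makes its last state one of
  positive probability, so \<open>transition_probability\<close> applies.\<close>

lemma prob_path_Suc:
  assumes "x n \<in> {1..b}" "j \<in> {1..b}"
  shows "\<P>(\<omega> in M. (\<forall>k\<le>n. \<xi> k \<omega> = x k) \<and> \<xi> (Suc n) \<omega> = j)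
    = \<P>(\<omega> in M. \<forall>k\<le>n. \<xi> k \<omega> = x k) * p (Suc n) (x n) j"
proof (cases "0 < \<P>(\<omega> in M. \<forall>k\<le>n. \<xi> k \<omega> = x k)")
  case True
  have "\<P>(\<omega> in M. \<forall>k\<le>n. \<xi> k \<omega> = x k) \<le> \<P>(\<omega> in M. \<xi> n \<omega> = x n)"
    by (intro finite_measure_mono) auto
  then have pos: "0 < \<P>(\<omega> in M. \<xi> n \<omega> = x n)" using True by linarith
  have "\<P>(\<omega> in M. \<xi> (Suc n) \<omega> = j \<bar> \<forall>k\<le>n. \<xi> k \<omega> = x k) = p (Suc n) (x n) j"
    using markov_property[OF assms(2) True] transition_probability[OF assms pos] by simp
  then show ?thesis using True by (simp add: cond_prob_def field_simps conj_commute)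
next
  case False
  then have 0: "\<P>(\<omega> in M. \<forall>k\<le>n. \<xi> k \<omega> = x k) = 0" by (simp add: zero_less_measure_iff)
  have "\<P>(\<omega> in M. (\<forall>k\<le>n. \<xi> k \<omega> = x k) \<and> \<xi> (Suc n) \<omega> = j) \<le> \<P>(\<omega> in M. \<forall>k\<le>n. \<xi> k \<omega> = x k)"
    by (intro finite_measure_mono) auto
  then show ?thesis using 0 by (simp add: measure_le_0_iff)
qed

text \<open>The supermartingale step without conditional expectations: since the state space is
  finite, the expectation splits into a finite sum over the paths up to time \<open>n\<close>. On
  each path \<open>F\<close> is constant, and summing over the next state produces the row sum
  bounded by \<open>h\<close>.\<close>

lemma expectation_path_step:
  fixes F :: "(nat \<Rightarrow> nat) \<Rightarrow> real" and h :: "nat \<Rightarrow> nat \<Rightarrow> real"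
  assumes F_local: "\<And>y z. (\<And>k. k \<le> n \<Longrightarrow> y k = z k) \<Longrightarrow> F y = F z"
    and F0: "\<And>y. 0 \<le> F y"
    and h: "\<And>i. i \<in> {1..b} \<Longrightarrow> (\<Sum>j\<in>{1..b}. p (Suc n) i j * h i j) \<le> 1"
  shows "expectation (\<lambda>\<omega>. F (\<lambda>k. \<xi> k \<omega>) * h (\<xi> n \<omega>) (\<xi> (Suc n) \<omega>))
    \<le> expectation (\<lambda>\<omega>. F (\<lambda>k. \<xi> k \<omega>))"
proof -
  \<comment> \<open>Extensional functions make the path of each outcome a unique element of
    \<open>X\<close>; \<open>F_local\<close> permits evaluating \<open>F\<close> at the restricted
    path.\<close>
  define X where "X = {..n} \<rightarrow>\<^sub>E {1..b}"
  define C where "C = (\<lambda>x. {\<omega>\<in>space M. \<forall>k\<le>n. \<xi> k \<omega> = x k})"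
  define C' where "C' = (\<lambda>x j. {\<omega>\<in>space M. (\<forall>k\<le>n. \<xi> k \<omega> = x k) \<and> \<xi> (Suc n) \<omega> = j})"
  have fin: "finite X" by (auto simp: X_def intro: finite_PiE)
  have ev: "C x \<in> events" "C' x j \<in> events" for x j
    by (auto simp: C_def C'_def)
  have unique: "\<omega> \<in> C x \<longleftrightarrow> x = restrict (\<lambda>k. \<xi> k \<omega>) {..n}" if "\<omega> \<in> space M" "x \<in> X" for x \<omega>
    using that by (fastforce simp: C_def X_def fun_eq_iff PiE_def extensional_def)
  have inX: "restrict (\<lambda>k. \<xi> k \<omega>) {..n} \<in> X" if "\<omega> \<in> space M" for \<omega>
    using state_in[OF that] by (auto simp: X_def)
  have pathsum: "(\<Sum>x\<in>X. G x * indicator (C x) \<omega>) = G (restrict (\<lambda>k. \<xi> k \<omega>) {..n})"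
    if "\<omega> \<in> space M" for G :: "(nat \<Rightarrow> nat) \<Rightarrow> real" and \<omega>
  proof -
    have "(\<Sum>x\<in>X. G x * indicator (C x) \<omega>)
        = (\<Sum>x\<in>X. if x = restrict (\<lambda>k. \<xi> k \<omega>) {..n} then G x else 0)"
      using unique[OF that] by (intro sum.cong) (auto simp: indicator_def)
    then show ?thesis using inX[OF that] fin by simp
  qed
  have F_restrict: "F (restrict (\<lambda>k. \<xi> k \<omega>) {..n}) = F (\<lambda>k. \<xi> k \<omega>)" for \<omega>
    by (rule F_local) auto
  have "expectation (\<lambda>\<omega>. F (\<lambda>k. \<xi> k \<omega>) * h (\<xi> n \<omega>) (\<xi> (Suc n) \<omega>))
      = expectation (\<lambda>\<omega>. \<Sum>x\<in>X. \<Sum>j\<in>{1..b}. F x * h (x n) j * indicator (C' x j) \<omega>)"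
  proof (rule Bochner_Integration.integral_cong)
    fix \<omega> assume \<omega>: "\<omega> \<in> space M"
    have "(\<Sum>x\<in>X. \<Sum>j\<in>{1..b}. F x * h (x n) j * indicator (C' x j) \<omega>)
        = (\<Sum>x\<in>X. (\<Sum>j\<in>{1..b}. if j = \<xi> (Suc n) \<omega> then F x * h (x n) j else 0) * indicator (C x) \<omega>)"
      unfolding sum_distrib_right by (intro sum.cong) (auto simp: indicator_def C_def C'_def)
    also have "\<dots> = (\<Sum>x\<in>X. (F x * h (x n) (\<xi> (Suc n) \<omega>)) * indicator (C x) \<omega>)"
      using state_in[OF \<omega>] by simp
    also have "\<dots> = F (\<lambda>k. \<xi> k \<omega>) * h (\<xi> n \<omega>) (\<xi> (Suc n) \<omega>)"
      unfolding pathsum[OF \<omega>] F_restrict by simp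
    finally show "F (\<lambda>k. \<xi> k \<omega>) * h (\<xi> n \<omega>) (\<xi> (Suc n) \<omega>)
      = (\<Sum>x\<in>X. \<Sum>j\<in>{1..b}. F x * h (x n) j * indicator (C' x j) \<omega>)" by simp
  qed simp
  also have "\<dots> = (\<Sum>x\<in>X. \<Sum>j\<in>{1..b}. F x * h (x n) j * prob (C' x j))"
    by (simp add: Bochner_Integration.integral_sum ev less_top[symmetric] del: sum_mult_indicator)
  also have "\<dots> = (\<Sum>x\<in>X. F x * prob (C x) * (\<Sum>j\<in>{1..b}. p (Suc n) (x n) j * h (x n) j))"
  proof (intro sum.cong refl)
    fix x assume "x \<in> X"
    then have "x n \<in> {1..b}" by (auto simp: X_def)
    then have "prob (C' x j) = prob (C x) * p (Suc n) (x n) j" if "j \<in> {1..b}" for j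
      using prob_path_Suc that by (simp add: C_def C'_def)
    then show "(\<Sum>j\<in>{1..b}. F x * h (x n) j * prob (C' x j))
        = F x * prob (C x) * (\<Sum>j\<in>{1..b}. p (Suc n) (x n) j * h (x n) j)"
      by (simp add: sum_distrib_left mult_ac)
  qed
  also have "\<dots> \<le> (\<Sum>x\<in>X. F x * prob (C x) * 1)"
    by (intro sum_mono mult_left_mono h mult_nonneg_nonneg F0) (auto simp: X_def)
  also have "\<dots> = expectation (\<lambda>\<omega>. \<Sum>x\<in>X. F x * indicator (C x) \<omega>)"
    by (simp add: Bochner_Integration.integral_sum ev less_top[symmetric] del: sum_mult_indicator)
  also have "\<dots> = expectation (\<lambda>\<omega>. F (\<lambda>k. \<xi> k \<omega>))"
    by (rule Bochner_Integration.integral_cong) (simp_all add: pathsum F_restrict)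
  finally show ?thesis .
qed

text \<open>Induction peels off the last factor; the earlier ones depend only on times up to
  \<open>m + n\<close>. The bound holds for every start \<open>m\<close> and every law of
  \<open>\<xi> m\<close>.\<close>

lemma expectation_prod_le_1:
  fixes h :: "nat \<Rightarrow> nat \<Rightarrow> nat \<Rightarrow> real"
  assumes h0: "\<And>k i j. 0 \<le> h k i j"
    and h: "\<And>k i. 1 \<le> k \<Longrightarrow> i \<in> {1..b} \<Longrightarrow> (\<Sum>j\<in>{1..b}. p k i j * h k i j) \<le> 1"
  shows "expectation (\<lambda>\<omega>. \<Prod>k\<in>{m + 1..m + n}. h k (\<xi> (k - 1) \<omega>) (\<xi> k \<omega>)) \<le> 1"
proof (induction n)
  case 0
  show ?case by (simp add: prob_space)
next
  case (Suc n)
  let ?F = "\<lambda>y. \<Prod>k\<in>{m + 1..m + n}. h k (y (k - 1)) (y k)"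
  have "expectation (\<lambda>\<omega>. \<Prod>k\<in>{m + 1..m + Suc n}. h k (\<xi> (k - 1) \<omega>) (\<xi> k \<omega>))
     = expectation (\<lambda>\<omega>. ?F (\<lambda>k. \<xi> k \<omega>) * h (Suc (m + n)) (\<xi> (m + n) \<omega>) (\<xi> (Suc (m + n)) \<omega>))"
    by (simp add: mult.commute)
  also have "\<dots> \<le> expectation (\<lambda>\<omega>. ?F (\<lambda>k. \<xi> k \<omega>))"
    by (rule expectation_path_step) (auto intro!: prod.cong prod_nonneg h0 h[simplified])
  also have "\<dots> \<le> 1" by (rule Suc)
  finally show ?case .
qed

text \<open>A martingale difference: the subtracted sum is the conditional mean given the previous
  state. The windows contain only \<open>k \<ge> 1\<close>, so the truncated \<open>k - 1\<close> is
  harmless.\<close>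

definition centered :: "(nat \<Rightarrow> nat \<Rightarrow> nat \<Rightarrow> real) \<Rightarrow> nat \<Rightarrow> 'a \<Rightarrow> real" where
  "centered g k \<omega> = g k (\<xi> (k - 1) \<omega>) (\<xi> k \<omega>)
     - (\<Sum>j\<in>{1..b}. p k (\<xi> (k - 1) \<omega>) j * g k (\<xi> (k - 1) \<omega>) j)"

lemma measurable_centered[measurable]: "centered g k \<in> borel_measurable M"
proof -
  \<comment> \<open>The pair takes values in a discrete space, on which every function is
    measurable.\<close>
  have "(\<lambda>\<omega>. (\<xi> (k - 1) \<omega>, \<xi> k \<omega>)) \<in> measurable M (count_space ({1..b} \<times> {1..b}))"
    by (subst pair_measure_countable[symmetric])
      (auto intro!: measurable_Pair random_variable[simplified])
  from measurable_compose[OF this, of "\<lambda>(i, j). g k i j - (\<Sum>l\<in>{1..b}. p k i l * g k i l)" borel]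
  show ?thesis by (simp add: centered_def[abs_def])
qed

text \<open>Chernoff bound from Markov's inequality for \<open>Z\<close>. The rate depends only on
  \<epsilon> and \<open>K\<close>, not on \<open>m\<close>, which is what permits arbitrary window
  positions \<open>a n\<close>.\<close>

lemma prob_centered_ge:
  fixes g :: "nat \<Rightarrow> nat \<Rightarrow> nat \<Rightarrow> real"
  assumes K: "0 < K"
    and g: "\<And>k i. 1 \<le> k \<Longrightarrow> i \<in> {1..b} \<Longrightarrow> (\<Sum>j\<in>{1..b}. p k i j * exp \<bar>g k i j\<bar>) \<le> K"
    and \<epsilon>: "0 < \<epsilon>"
  shows "\<P>(\<omega> in M. \<epsilon> * real n \<le> (\<Sum>k\<in>{m + 1..m + n}. centered g k \<omega>))
    \<le> exp (- (min 1 (\<epsilon> / (2 * K)) * \<epsilon> / 2) * real n)"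
proof -
  \<comment> \<open>\<open>s \<epsilon> - s\<^sup>2 K\<close> is maximal at \<open>\<epsilon> / (2 K)\<close>, but the quadratic bound on \<open>exp\<close> needs \<open>s \<le> 1\<close>.\<close>
  define s where "s = min 1 (\<epsilon> / (2 * K))"
  have s: "0 < s" "s \<le> 1" "s * K \<le> \<epsilon> / 2"
    using K \<epsilon> by (auto simp: s_def min_def field_simps)
  \<comment> \<open>By the quadratic estimate the conditional mean of \<open>exp (s * g)\<close> is
    at most \<open>exp (s * \<mu> + s\<^sup>2 * K)\<close>, with \<mu> the row mean of
    \<open>g\<close>; \<open>h\<close> divides by exactly this bound.\<close>
  define h where "h = (\<lambda>k i j. exp (s * g k i j - s * (\<Sum>l\<in>{1..b}. p k i l * g k i l) - s\<^sup>2 * K))"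
  have h: "(\<Sum>j\<in>{1..b}. p k i j * h k i j) \<le> 1" if k: "1 \<le> k" and i: "i \<in> {1..b}" for k i
  proof -
    define \<mu> where "\<mu> = (\<Sum>l\<in>{1..b}. p k i l * g k i l)"
    have tm: "\<And>j. j \<in> {1..b} \<Longrightarrow> 0 \<le> p k i j" "(\<Sum>j\<in>{1..b}. p k i j) = 1"
      using transition_matrices[OF k] i by (auto simp: transition_matrix_def)
    have "(\<Sum>j\<in>{1..b}. p k i j * exp (s * g k i j))
       \<le> (\<Sum>j\<in>{1..b}. p k i j * (1 + s * g k i j + s\<^sup>2 * exp \<bar>g k i j\<bar>))"
      using s tm by (intro sum_mono mult_left_mono exp_mult_le_quadratic) auto
    also have "\<dots> = 1 + s * \<mu> + s\<^sup>2 * (\<Sum>j\<in>{1..b}. p k i j * exp \<bar>g k i j\<bar>)"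
      using tm(2) by (simp add: \<mu>_def sum_distrib_left distrib_left sum.distrib mult_ac)
    also have "\<dots> \<le> 1 + (s * \<mu> + s\<^sup>2 * K)"
      using g[OF k i] by (simp add: mult_left_mono)
    also have "\<dots> \<le> exp (s * \<mu> + s\<^sup>2 * K)" by (rule exp_ge_add_one_self)
    finally have le: "(\<Sum>j\<in>{1..b}. p k i j * exp (s * g k i j)) \<le> exp (s * \<mu> + s\<^sup>2 * K)" .
    have "h k i j = exp (s * g k i j) / exp (s * \<mu> + s\<^sup>2 * K)" for j
      by (simp add: h_def \<mu>_def flip: exp_diff)
    then have "(\<Sum>j\<in>{1..b}. p k i j * h k i j)
        = (\<Sum>j\<in>{1..b}. p k i j * exp (s * g k i j)) / exp (s * \<mu> + s\<^sup>2 * K)"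
      by (simp add: sum_divide_distrib)
    then show ?thesis using le by simp
  qed
  define Z where "Z = (\<lambda>\<omega>. \<Prod>k\<in>{m + 1..m + n}. h k (\<xi> (k - 1) \<omega>) (\<xi> k \<omega>))"
  have Z: "Z \<omega> = exp (s * (\<Sum>k\<in>{m + 1..m + n}. centered g k \<omega>) - s\<^sup>2 * K * real n)" for \<omega>
  proof -
    have "Z \<omega> = exp (\<Sum>k\<in>{m + 1..m + n}. s * centered g k \<omega> - s\<^sup>2 * K)"
      unfolding Z_def by (subst exp_sum) (auto simp: h_def centered_def algebra_simps)
    then show ?thesis by (simp add: sum_subtractf sum_distrib_left mult_ac)
  qed
  have EZ: "expectation Z \<le> 1"
    unfolding Z_def by (rule expectation_prod_le_1) (auto simp: h_def intro: h[unfolded h_def, simplified])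
  have Zm[measurable]: "Z \<in> borel_measurable M"
    unfolding Z[abs_def] by measurable
  \<comment> \<open>A crude bound summing over all pairs of states; it serves only the integrability
    of \<open>Z\<close>.\<close>
  define B where "B = (\<Sum>k\<in>{m+1..m+n}. \<Sum>i\<in>{1..b}. \<Sum>j\<in>{1..b}.
      \<bar>g k i j - (\<Sum>l\<in>{1..b}. p k i l * g k i l)\<bar>)"
  have "integrable M Z"
  proof (rule integrable_const_bound[where B = "exp (s * B)"])
    show "AE \<omega> in M. norm (Z \<omega>) \<le> exp (s * B)"
    proof (rule AE_I2)
      fix \<omega> assume \<omega>: "\<omega> \<in> space M"
      have "(\<Sum>k\<in>{m + 1..m + n}. centered g k \<omega>) \<le> B"
        unfolding B_def
      proof (rule sum_mono)
        fix k
        let ?d = "\<lambda>i j. \<bar>g k i j - (\<Sum>l\<in>{1..b}. p k i l * g k i l)\<bar>"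
        have "centered g k \<omega> \<le> ?d (\<xi> (k - 1) \<omega>) (\<xi> k \<omega>)" by (simp add: centered_def)
        also have "\<dots> \<le> (\<Sum>j\<in>{1..b}. ?d (\<xi> (k - 1) \<omega>) j)"
          using state_in[OF \<omega>] by (intro member_le_sum) auto
        also have "\<dots> \<le> (\<Sum>i\<in>{1..b}. \<Sum>j\<in>{1..b}. ?d i j)"
          using state_in[OF \<omega>]
          by (intro member_le_sum[of _ _ "\<lambda>i. \<Sum>j\<in>{1..b}. ?d i j"] sum_nonneg) auto
        finally show "centered g k \<omega> \<le> (\<Sum>i\<in>{1..b}. \<Sum>j\<in>{1..b}. ?d i j)" .
      qed
      then have "s * (\<Sum>k\<in>{m + 1..m + n}. centered g k \<omega>) \<le> s * B"
        using s by simp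
      moreover have "0 \<le> s\<^sup>2 * K * real n" using K by simp
      ultimately show "norm (Z \<omega>) \<le> exp (s * B)"
        unfolding Z real_norm_def abs_exp_cancel exp_le_cancel_iff by linarith
    qed
  qed simp
  \<comment> \<open>Half of the exponent \<open>s * \<epsilon> * n\<close> survives, because
    \<open>s * K \<le> \<epsilon> / 2\<close> limits the correction to the other half.\<close>
  define c where "c = exp (s * \<epsilon> / 2 * real n)"
  have "\<P>(\<omega> in M. \<epsilon> * real n \<le> (\<Sum>k\<in>{m + 1..m + n}. centered g k \<omega>)) \<le> \<P>(\<omega> in M. c \<le> Z \<omega>)"
  proof (intro finite_measure_mono Collect_mono impI conjI; (elim conjE)?)
    fix \<omega> assume "\<epsilon> * real n \<le> (\<Sum>k\<in>{m + 1..m + n}. centered g k \<omega>)"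
    then have "s * (\<epsilon> * real n) \<le> s * (\<Sum>k\<in>{m + 1..m + n}. centered g k \<omega>)"
      using s by simp
    moreover have "s\<^sup>2 * K * real n \<le> s * \<epsilon> / 2 * real n"
      using mult_left_mono[OF s(3), of s] s(1) by (intro mult_right_mono) (auto simp: power2_eq_square)
    ultimately show "c \<le> Z \<omega>" by (simp add: c_def Z algebra_simps)
  qed auto
  also have "\<dots> \<le> expectation Z / c"
    by (rule integral_Markov_inequality_measure[of _ _ "{}"])
      (use \<open>integrable M Z\<close> in \<open>auto simp: c_def Z[abs_def]\<close>)
  also have "\<dots> \<le> 1 / c" by (rule divide_right_mono[OF EZ]) (simp add: c_def)
  also have "\<dots> = exp (- (s * \<epsilon> / 2) * real n)" by (simp add: c_def exp_minus inverse_eq_divide)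
  finally show ?thesis by (simp add: s_def)
qed

section \<open>Almost sure limits by Borel-Cantelli\<close>

text \<open>The thresholds \<open>1 / real (Suc m)\<close> suffice, so only countably many null sets
  are united.\<close>

lemma AE_tendsto_0_divide:
  fixes X :: "nat \<Rightarrow> 'a \<Rightarrow> real" and \<phi> :: "nat \<Rightarrow> nat"
  assumes "\<And>e. 0 < e \<Longrightarrow> AE \<omega> in M. \<forall>\<^sub>F n in sequentially. \<bar>X n \<omega>\<bar> \<le> e * real (\<phi> n)"
  shows "AE \<omega> in M. (\<lambda>n. 1 / real (\<phi> n) * X n \<omega>) \<longlonglongrightarrow> 0"
proof -
  have "AE \<omega> in M. \<forall>m. \<forall>\<^sub>F n in sequentially. \<bar>X n \<omega>\<bar> \<le> 1 / real (Suc m) * real (\<phi> n)"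
    unfolding AE_all_countable by (intro allI assms) simp
  then show ?thesis
  proof (rule eventually_mono)
    fix \<omega> assume *: "\<forall>m. \<forall>\<^sub>F n in sequentially. \<bar>X n \<omega>\<bar> \<le> 1 / real (Suc m) * real (\<phi> n)"
    show "(\<lambda>n. 1 / real (\<phi> n) * X n \<omega>) \<longlonglongrightarrow> 0"
    proof (rule tendstoI)
      fix e :: real assume "0 < e"
      then obtain m where m: "1 / real (Suc m) < e"
        using nat_approx_posE by blast
      show "\<forall>\<^sub>F n in sequentially. dist (1 / real (\<phi> n) * X n \<omega>) 0 < e"
        using *[rule_format, of m]
      proof (rule eventually_mono)
        fix n assume le: "\<bar>X n \<omega>\<bar> \<le> 1 / real (Suc m) * real (\<phi> n)"
        have "1 / real (\<phi> n) * \<bar>X n \<omega>\<bar> \<le> 1 / real (Suc m)"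
          using le by (cases "\<phi> n = 0") (auto simp: field_simps)
        then show "dist (1 / real (\<phi> n) * X n \<omega>) 0 < e"
          using m by (simp add: abs_mult dist_real_def)
      qed
    qed
  qed
qed

text \<open>The Chernoff probabilities are summable by the growth condition on \<phi>. The lower
  tail is the upper tail of \<open>- g\<close>, which satisfies the same moment bound; hence
  \<open>upper\<close> is stated for all \<open>g'\<close> with the absolute values of
  \<open>g\<close>.\<close>

lemma AE_centered_average_tendsto_0:
  fixes g :: "nat \<Rightarrow> nat \<Rightarrow> nat \<Rightarrow> real" and a \<phi> :: "nat \<Rightarrow> nat"
  assumes summable: "\<And>\<epsilon>::real. \<epsilon> > 0 \<Longrightarrow> summable (\<lambda>n. exp (- \<epsilon> * real (\<phi> n)))"
    and K: "0 < K"
    and g: "\<And>k i. 1 \<le> k \<Longrightarrow> i \<in> {1..b} \<Longrightarrow> (\<Sum>j\<in>{1..b}. p k i j * exp \<bar>g k i j\<bar>) \<le> K"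
  shows "AE \<omega> in M. (\<lambda>n. 1 / real (\<phi> n) * (\<Sum>k\<in>{a n + 1..a n + \<phi> n}. centered g k \<omega>)) \<longlonglongrightarrow> 0"
proof (rule AE_tendsto_0_divide)
  fix e :: real assume e: "0 < e"
  have upper: "AE \<omega> in M. \<forall>\<^sub>F n in sequentially.
      \<omega> \<in> space M - {\<omega>\<in>space M. e * real (\<phi> n) \<le> (\<Sum>k\<in>{a n + 1..a n + \<phi> n}. centered g' k \<omega>)}"
    if g': "\<And>k i j. \<bar>g' k i j\<bar> = \<bar>g k i j\<bar>" for g'
  proof (rule borel_cantelli_AE1)
    have "0 < min 1 (e / (2 * K)) * e / 2" using e K by simp
    from summable[OF this]
    show "summable (\<lambda>n. \<P>(\<omega> in M. e * real (\<phi> n) \<le> (\<Sum>k\<in>{a n + 1..a n + \<phi> n}. centered g' k \<omega>)))"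
    proof (rule summable_comparison_test')
      fix n
      show "norm (\<P>(\<omega> in M. e * real (\<phi> n) \<le> (\<Sum>k\<in>{a n + 1..a n + \<phi> n}. centered g' k \<omega>)))
          \<le> exp (- (min 1 (e / (2 * K)) * e / 2) * real (\<phi> n))"
        using prob_centered_ge[OF K _ e, of g' "\<phi> n" "a n"] g unfolding g' by simp
    qed
  qed (simp_all add: less_top[symmetric])
  have neg: "centered (\<lambda>k i j. - g k i j) k \<omega> = - centered g k \<omega>" for k \<omega>
    by (simp add: centered_def sum_negf)
  show "AE \<omega> in M. \<forall>\<^sub>F n in sequentially.
      \<bar>\<Sum>k\<in>{a n + 1..a n + \<phi> n}. centered g k \<omega>\<bar> \<le> e * real (\<phi> n)"
    using upper[of g, OF refl] upper[of "\<lambda>k i j. - g k i j", OF abs_minus_cancel]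
  proof eventually_elim
    case (elim \<omega>)
    then show ?case
      by eventually_elim (auto simp: neg sum_negf)
  qed
qed

text \<open>The law of \<open>\<xi> (a n)\<close> may have tiny atoms, but these are rarely
  observed: at most \<open>b\<close> states have mass at most
  \<open>exp (- e * real (\<phi> n))\<close>, so seeing one has summable probability.\<close>

lemma AE_log_initial_tendsto_0:
  fixes a \<phi> :: "nat \<Rightarrow> nat"
  assumes summable: "\<And>\<epsilon>::real. \<epsilon> > 0 \<Longrightarrow> summable (\<lambda>n. exp (- \<epsilon> * real (\<phi> n)))"
  shows "AE \<omega> in M. (\<lambda>n. 1 / real (\<phi> n) * ln \<P>(\<omega>' in M. \<xi> (a n) \<omega>' = \<xi> (a n) \<omega>)) \<longlonglongrightarrow> 0"
proof (rule AE_tendsto_0_divide)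
  fix e :: real assume e: "0 < e"
  define q where "q = (\<lambda>n i. \<P>(\<omega> in M. \<xi> n \<omega> = i))"
  define A where "A = (\<lambda>n. {\<omega>\<in>space M. q (a n) (\<xi> (a n) \<omega>) \<le> exp (- e * real (\<phi> n))})"
  have A_events: "A n \<in> events" for n
  proof -
    have [measurable]: "q (a n) \<in> borel_measurable (count_space {1..b})" by simp
    show ?thesis unfolding A_def by measurable
  qed
  have "prob (A n) \<le> real b * exp (- e * real (\<phi> n))" for n
  proof -
    define S where "S = {i\<in>{1..b}. q (a n) i \<le> exp (- e * real (\<phi> n))}"
    have "A n \<subseteq> (\<Union>i\<in>S. {\<omega>\<in>space M. \<xi> (a n) \<omega> = i})"
      using state_in by (auto simp: A_def S_def)
    then have "prob (A n) \<le> prob (\<Union>i\<in>S. {\<omega>\<in>space M. \<xi> (a n) \<omega> = i})"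
      by (intro finite_measure_mono) (auto simp: S_def)
    also have "\<dots> \<le> (\<Sum>i\<in>S. q (a n) i)"
      unfolding q_def by (intro measure_UNION_le) (auto simp: S_def)
    also have "\<dots> \<le> real (card S) * exp (- e * real (\<phi> n))"
      by (rule sum_bounded_above) (simp add: S_def)
    also have "\<dots> \<le> real b * exp (- e * real (\<phi> n))"
    proof -
      have "card S \<le> card {1..b}" by (intro card_mono) (auto simp: S_def)
      then show ?thesis by (intro mult_right_mono) auto
    qed
    finally show ?thesis .
  qed
  then have "summable (\<lambda>n. prob (A n))"
    by (intro summable_comparison_test'[OF summable_mult[OF summable[OF e], of "real b"]]) simp
  then have "AE \<omega> in M. \<forall>\<^sub>F n in sequentially. \<omega> \<in> space M - A n"
    by (intro borel_cantelli_AE1 A_events) (simp_all add: less_top[symmetric])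
  then show "AE \<omega> in M. \<forall>\<^sub>F n in sequentially.
      \<bar>ln \<P>(\<omega>' in M. \<xi> (a n) \<omega>' = \<xi> (a n) \<omega>)\<bar> \<le> e * real (\<phi> n)"
  proof (rule eventually_mono)
    fix \<omega> assume "\<forall>\<^sub>F n in sequentially. \<omega> \<in> space M - A n"
    then show "\<forall>\<^sub>F n in sequentially.
      \<bar>ln \<P>(\<omega>' in M. \<xi> (a n) \<omega>' = \<xi> (a n) \<omega>)\<bar> \<le> e * real (\<phi> n)"
    proof (rule eventually_mono)
      fix n assume "\<omega> \<in> space M - A n"
      then have lower: "exp (- e * real (\<phi> n)) < q (a n) (\<xi> (a n) \<omega>)" by (auto simp: A_def)
      then have pos: "0 < q (a n) (\<xi> (a n) \<omega>)" by (meson exp_gt_zero less_trans)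
      have "- e * real (\<phi> n) < ln (q (a n) (\<xi> (a n) \<omega>))"
        using lower pos by (metis exp_gt_zero ln_exp ln_less_cancel_iff)
      moreover have "ln (q (a n) (\<xi> (a n) \<omega>)) \<le> 0"
        using pos by (simp add: q_def)
      ultimately show "\<bar>ln \<P>(\<omega>' in M. \<xi> (a n) \<omega>' = \<xi> (a n) \<omega>)\<bar> \<le> e * real (\<phi> n)"
        by (simp add: q_def)
    qed
  qed
qed

section \<open>From time averages to state frequencies\<close>

text \<open>As \<open>k\<close> runs through \<open>{m + 1..m + n}\<close>, \<open>k - 1\<close>
  runs through the range counted by \<open>state_count\<close>.\<close>

lemma sum_previous_state:
  fixes G :: "nat \<Rightarrow> real"
  assumes "\<omega> \<in> space M"
  shows "(\<Sum>k\<in>{m + 1..m + n}. G (\<xi> (k - 1) \<omega>)) = (\<Sum>i\<in>{1..b}. state_count \<xi> m n i \<omega> * G i)"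
proof -
  have "(\<Sum>k\<in>{m + 1..m + n}. G (\<xi> (k - 1) \<omega>)) = (\<Sum>k\<in>{m..<m + n}. G (\<xi> k \<omega>))"
    using sum.shift_bounds_Suc_ivl[of "\<lambda>k. G (\<xi> (k - 1) \<omega>)" m "m + n"]
    by (simp add: atLeastLessThanSuc_atLeastAtMost)
  also have "\<dots> = (\<Sum>k\<in>{m..<m + n}. \<Sum>i\<in>{1..b}. indicator {i} (\<xi> k \<omega>) * G i)"
  proof (intro sum.cong refl)
    fix k
    have "(\<Sum>i\<in>{1..b}. indicator {i} (\<xi> k \<omega>) * G i) = (\<Sum>i\<in>{1..b}. if i = \<xi> k \<omega> then G i else 0)"
      by (intro sum.cong) (auto simp: indicator_def)
    then show "G (\<xi> k \<omega>) = (\<Sum>i\<in>{1..b}. indicator {i} (\<xi> k \<omega>) * G i)"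
      using state_in[OF assms] by simp
  qed
  also have "\<dots> = (\<Sum>i\<in>{1..b}. state_count \<xi> m n i \<omega> * G i)"
    by (subst sum.swap) (simp add: state_count_def sum_distrib_right)
  finally show ?thesis .
qed

text \<open>The common source of all three limits, used for pair indicators and for
  \<open>ln (p k i j)\<close>. The average of \<open>g\<close> splits into a martingale part and a
  compensator; the latter is replaced by \<open>G\<close> and regrouped by states.\<close>

lemma AE_average_tendsto_0:
  fixes g :: "nat \<Rightarrow> nat \<Rightarrow> nat \<Rightarrow> real" and G :: "nat \<Rightarrow> real" and a \<phi> :: "nat \<Rightarrow> nat"
  assumes summable: "\<And>\<epsilon>::real. \<epsilon> > 0 \<Longrightarrow> summable (\<lambda>n. exp (- \<epsilon> * real (\<phi> n)))"
    and K: "0 < K"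
    and g: "\<And>k i. 1 \<le> k \<Longrightarrow> i \<in> {1..b} \<Longrightarrow> (\<Sum>j\<in>{1..b}. p k i j * exp \<bar>g k i j\<bar>) \<le> K"
    and G: "\<And>i. i \<in> {1..b} \<Longrightarrow> (\<lambda>n. 1 / real (\<phi> n) *
        (\<Sum>k\<in>{a n + 1..a n + \<phi> n}. \<bar>(\<Sum>j\<in>{1..b}. p k i j * g k i j) - G i\<bar>)) \<longlonglongrightarrow> 0"
  shows "AE \<omega> in M. (\<lambda>n. 1 / real (\<phi> n) * (\<Sum>k\<in>{a n + 1..a n + \<phi> n}. g k (\<xi> (k - 1) \<omega>) (\<xi> k \<omega>))
     - (\<Sum>i\<in>{1..b}. 1 / real (\<phi> n) * state_count \<xi> (a n) (\<phi> n) i \<omega> * G i)) \<longlonglongrightarrow> 0"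
proof -
  have "AE \<omega> in M. (\<lambda>n. 1 / real (\<phi> n) * (\<Sum>k\<in>{a n + 1..a n + \<phi> n}. centered g k \<omega>)) \<longlonglongrightarrow> 0"
    by (rule AE_centered_average_tendsto_0[OF _ K]) (use summable g in auto)
  then show ?thesis using AE_space
  proof eventually_elim
    case (elim \<omega>)
    define H where "H = (\<lambda>k i. \<Sum>j\<in>{1..b}. p k i j * g k i j)"
    let ?I = "\<lambda>n. {a n + 1..a n + \<phi> n}"
    \<comment> \<open>The previous state is random, so the error is dominated by its sum over all
      states, to which the deterministic hypothesis applies.\<close>
    have "(\<lambda>n. 1 / real (\<phi> n) * (\<Sum>k\<in>?I n. H k (\<xi> (k - 1) \<omega>) - G (\<xi> (k - 1) \<omega>))) \<longlonglongrightarrow> 0"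
    proof (rule Lim_null_comparison[OF always_eventually], rule allI)
      show "(\<lambda>n. \<Sum>i\<in>{1..b}. 1 / real (\<phi> n) * (\<Sum>k\<in>?I n. \<bar>H k i - G i\<bar>)) \<longlonglongrightarrow> 0"
        unfolding H_def by (intro tendsto_null_sum G)
      fix n
      have "\<bar>\<Sum>k\<in>?I n. H k (\<xi> (k - 1) \<omega>) - G (\<xi> (k - 1) \<omega>)\<bar>
          \<le> (\<Sum>k\<in>?I n. \<bar>H k (\<xi> (k - 1) \<omega>) - G (\<xi> (k - 1) \<omega>)\<bar>)"
        by (rule sum_abs)
      also have "\<dots> \<le> (\<Sum>k\<in>?I n. \<Sum>i\<in>{1..b}. \<bar>H k i - G i\<bar>)"
        using state_in[OF elim(2)]
        by (intro sum_mono member_le_sum[of _ _ "\<lambda>i. \<bar>H _ i - G i\<bar>"]) auto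
      also have "\<dots> = (\<Sum>i\<in>{1..b}. \<Sum>k\<in>?I n. \<bar>H k i - G i\<bar>)"
        by (rule sum.swap)
      finally show "norm (1 / real (\<phi> n) * (\<Sum>k\<in>?I n. H k (\<xi> (k - 1) \<omega>) - G (\<xi> (k - 1) \<omega>)))
          \<le> (\<Sum>i\<in>{1..b}. 1 / real (\<phi> n) * (\<Sum>k\<in>?I n. \<bar>H k i - G i\<bar>))"
        unfolding sum_distrib_left[symmetric] real_norm_def abs_mult
        by (intro mult_mono) auto
    qed
    from tendsto_add[OF elim(1) this]
    have "(\<lambda>n. 1 / real (\<phi> n) * ((\<Sum>k\<in>?I n. centered g k \<omega>)
        + (\<Sum>k\<in>?I n. H k (\<xi> (k - 1) \<omega>) - G (\<xi> (k - 1) \<omega>)))) \<longlonglongrightarrow> 0"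
      by (simp add: distrib_left)
    moreover have "(\<Sum>k\<in>?I n. centered g k \<omega>) + (\<Sum>k\<in>?I n. H k (\<xi> (k - 1) \<omega>) - G (\<xi> (k - 1) \<omega>))
        = (\<Sum>k\<in>?I n. g k (\<xi> (k - 1) \<omega>) (\<xi> k \<omega>)) - (\<Sum>i\<in>{1..b}. state_count \<xi> (a n) (\<phi> n) i \<omega> * G i)" for n
      unfolding sum_previous_state[OF elim(2), symmetric] sum.distrib[symmetric] sum_subtractf[symmetric]
      by (simp add: centered_def H_def)
    ultimately show ?case
      by (simp add: diff_divide_distrib sum_divide_distrib)
  qed
qed

lemma sum_state_count:
  assumes "\<omega> \<in> space M"
  shows "(\<Sum>i\<in>{1..b}. state_count \<xi> m n i \<omega>) = real n"
  using sum_previous_state[OF assms, of "\<lambda>_. 1" m n] by simp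

text \<open>Pairs ending in \<open>j\<close> count visits one time unit later than
  \<open>state_count\<close> does; the difference telescopes to the two end terms.\<close>

lemma state_count_diff_pair_count:
  assumes "\<omega> \<in> space M"
  shows "\<bar>state_count \<xi> m n j \<omega> - (\<Sum>i\<in>{1..b}. pair_count \<xi> m n i j \<omega>)\<bar> \<le> 1"
proof -
  let ?f = "\<lambda>k. indicator {j} (\<xi> k \<omega>) :: real"
  have one: "(\<Sum>i\<in>{1..b}. indicator {i} (\<xi> k \<omega>)) = (1::real)" for k
  proof -
    have "(\<Sum>i\<in>{1..b}. indicator {i} (\<xi> k \<omega>)) = (\<Sum>i\<in>{1..b}. if i = \<xi> k \<omega> then 1 else (0::real))"
      by (intro sum.cong) (auto simp: indicator_def)
    then show ?thesis using state_in[OF assms] by simp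
  qed
  have "(\<Sum>i\<in>{1..b}. pair_count \<xi> m n i j \<omega>)
      = (\<Sum>k\<in>{m..<m + n}. (\<Sum>i\<in>{1..b}. indicator {i} (\<xi> k \<omega>)) * ?f (k + 1))"
    unfolding pair_count_def by (subst sum.swap) (simp add: sum_distrib_right)
  then have "(\<Sum>i\<in>{1..b}. pair_count \<xi> m n i j \<omega>) - state_count \<xi> m n j \<omega>
      = (\<Sum>k\<in>{m..<m + n}. ?f (Suc k) - ?f k)"
    unfolding one by (simp add: state_count_def sum_subtractf)
  also have "\<dots> = ?f (m + n) - ?f m"
    by (rule sum_Suc_diff') simp
  finally have "(\<Sum>i\<in>{1..b}. pair_count \<xi> m n i j \<omega>) - state_count \<xi> m n j \<omega> = ?f (m + n) - ?f m" .
  moreover have "0 \<le> ?f k" "?f k \<le> 1" for k by (simp_all add: indicator_def)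
  ultimately show ?thesis by (smt (verit))
qed

end

section \<open>Assembly of the three limits\<close>

theorem theorem1:
  fixes M :: "'a measure" and b :: nat and \<xi> :: "nat \<Rightarrow> 'a \<Rightarrow> nat"
    and \<mu>0 :: "nat \<Rightarrow> real" and p :: "nat \<Rightarrow> nat \<Rightarrow> nat \<Rightarrow> real"
    and a \<phi> :: "nat \<Rightarrow> nat"
    and P :: "nat \<Rightarrow> nat \<Rightarrow> real" and \<pi> :: "nat \<Rightarrow> real"
  assumes "nonhomogeneous_markov_chain M b \<xi> \<mu>0 p"
    and "filterlim \<phi> at_top sequentially"
    and "\<And>\<epsilon>::real. \<epsilon> > 0 \<Longrightarrow> summable (\<lambda>n. exp (- \<epsilon> * real (\<phi> (Suc n))))"
    and "transition_matrix b P"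
    and "irreducible_matrix b P"
    and "\<And>i j. i \<in> {1..b} \<Longrightarrow> j \<in> {1..b} \<Longrightarrow>
           (\<lambda>n. 1 / real (\<phi> n) * (\<Sum>k\<in>{a n + 1..a n + \<phi> n}. \<bar>p k i j - P i j\<bar>)) \<longlonglongrightarrow> 0"
    and "stationary_distribution b P \<pi>"
  shows "(\<forall>i\<in>{1..b}. AE \<omega> in M.
            (\<lambda>n. 1 / real (\<phi> n) * state_count \<xi> (a n) (\<phi> n) i \<omega>) \<longlonglongrightarrow> \<pi> i)
       \<and> (\<forall>i\<in>{1..b}. \<forall>j\<in>{1..b}. AE \<omega> in M.
            (\<lambda>n. 1 / real (\<phi> n) * pair_count \<xi> (a n) (\<phi> n) i j \<omega>) \<longlonglongrightarrow> \<pi> i * P i j)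
       \<and> (AE \<omega> in M.
            (\<lambda>n. segment_entropy_density M \<xi> p (a n) (\<phi> n) \<omega>)
              \<longlonglongrightarrow> - (\<Sum>i\<in>{1..b}. \<Sum>j\<in>{1..b}. \<pi> i * P i j * ln (P i j)))"
proof -
  interpret nonhomogeneous_markov_chain M b \<xi> \<mu>0 p by fact
  note P = assms(4,5) and p_lim = assms(6)
  have summable: "summable (\<lambda>n. exp (- \<epsilon> * real (\<phi> n)))" if "\<epsilon> > 0" for \<epsilon>
    using assms(3)[OF that] by (subst (asm) summable_Suc_iff)
  have p0: "0 \<le> p k i j" and p1: "p k i j \<le> 1" and p_sum: "(\<Sum>j\<in>{1..b}. p k i j) = 1"
    if "1 \<le> k" "i \<in> {1..b}" "j \<in> {1..b}" for k i j
  proof -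
    show p0: "0 \<le> p k i j" and p_sum: "(\<Sum>j\<in>{1..b}. p k i j) = 1"
      using transition_matrices[OF that(1)] that by (auto simp: transition_matrix_def)
    show "p k i j \<le> 1"
      unfolding p_sum[symmetric]
      using transition_matrices[OF that(1)] that
      by (intro member_le_sum) (auto simp: transition_matrix_def)
  qed
  have P01: "P i j \<in> {0..1}" if "i \<in> {1..b}" "j \<in> {1..b}" for i j
  proof -
    have "P i j \<le> (\<Sum>j\<in>{1..b}. P i j)"
      using P(1) that by (intro member_le_sum) (auto simp: transition_matrix_def)
    then show ?thesis using P(1) that by (auto simp: transition_matrix_def)
  qed
  define s where "s = (\<lambda>\<omega> n i. 1 / real (\<phi> n) * state_count \<xi> (a n) (\<phi> n) i \<omega>)"
  define t where "t = (\<lambda>\<omega> n i j. 1 / real (\<phi> n) * pair_count \<xi> (a n) (\<phi> n) i j \<omega>)"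
  have pair: "AE \<omega> in M. (\<lambda>n. t \<omega> n i j - s \<omega> n i * P i j) \<longlonglongrightarrow> 0"
    if i: "i \<in> {1..b}" and j: "j \<in> {1..b}" for i j
  proof -
    define g :: "nat \<Rightarrow> nat \<Rightarrow> nat \<Rightarrow> real" where "g = (\<lambda>k x y. indicator {i} x * indicator {j} y)"
    \<comment> \<open>The row mean of \<open>g\<close> is \<open>p k i j\<close> at
      \<open>l = i\<close> and 0 elsewhere; \<open>G\<close> is its limit in the averaged
      sense.\<close>
    define G where "G = (\<lambda>l. if l = i then P i j else 0)"
    have mean: "(\<Sum>y\<in>{1..b}. p k l y * g k l y) = (if l = i then p k i j else 0)" for k l
    proof -
      have "(\<Sum>y\<in>{1..b}. p k l y * g k l y) = (\<Sum>y\<in>{1..b}. if y = j then (if l = i then p k i j else 0) else 0)"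
        by (intro sum.cong) (auto simp: g_def)
      then show ?thesis using j by simp
    qed
    have "AE \<omega> in M. (\<lambda>n. 1 / real (\<phi> n) * (\<Sum>k\<in>{a n + 1..a n + \<phi> n}. g k (\<xi> (k - 1) \<omega>) (\<xi> k \<omega>))
     - (\<Sum>l\<in>{1..b}. 1 / real (\<phi> n) * state_count \<xi> (a n) (\<phi> n) l \<omega> * G l)) \<longlonglongrightarrow> 0"
    \<comment> \<open>The indicator is at most 1 and rows of \<open>p k\<close> sum to 1.\<close>
    proof (rule AE_average_tendsto_0[where K = "exp 1"])
      fix k l :: nat assume k: "1 \<le> k" and l: "l \<in> {1..b}"
      have "(\<Sum>j\<in>{1..b}. p k l j * exp \<bar>g k l j\<bar>) \<le> (\<Sum>j\<in>{1..b}. p k l j * exp 1)"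
        using p0[OF k l] by (intro sum_mono mult_left_mono) (auto simp: g_def indicator_def)
      also have "\<dots> = exp 1"
        using p_sum[OF k l l] by (simp flip: sum_distrib_right)
      finally show "(\<Sum>j\<in>{1..b}. p k l j * exp \<bar>g k l j\<bar>) \<le> exp 1" .
    next
      fix l assume "l \<in> {1..b}"
      show "(\<lambda>n. 1 / real (\<phi> n) *
        (\<Sum>k\<in>{a n + 1..a n + \<phi> n}. \<bar>(\<Sum>j\<in>{1..b}. p k l j * g k l j) - G l\<bar>)) \<longlonglongrightarrow> 0"
        unfolding mean G_def using p_lim[OF i j] by (cases "l = i") auto
    qed (use summable in auto)
    moreover have "1 / real (\<phi> n) * (\<Sum>k\<in>{a n + 1..a n + \<phi> n}. g k (\<xi> (k - 1) \<omega>) (\<xi> k \<omega>)) = t \<omega> n i j" for n \<omega>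
      using sum.shift_bounds_Suc_ivl[of "\<lambda>k. g k (\<xi> (k - 1) \<omega>) (\<xi> k \<omega>)" "a n" "a n + \<phi> n"]
      by (simp add: t_def g_def pair_count_def atLeastLessThanSuc_atLeastAtMost)
    moreover have "(\<Sum>l\<in>{1..b}. 1 / real (\<phi> n) * state_count \<xi> (a n) (\<phi> n) l \<omega> * G l) = s \<omega> n i * P i j" for n \<omega>
      using i by (simp add: G_def s_def if_distrib[of "\<lambda>x. _ * x"] cong: if_cong)
    ultimately show ?thesis by simp
  qed
  have pairs: "AE \<omega> in M. \<forall>i\<in>{1..b}. \<forall>j\<in>{1..b}. (\<lambda>n. t \<omega> n i j - s \<omega> n i * P i j) \<longlonglongrightarrow> 0"
    by (intro AE_finite_allI pair) auto
  \<comment> \<open>Pair frequencies tie \<open>s\<close> to \<open>s * P\<close>, and summing them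
    over the first state returns \<open>s\<close> up to \<open>1 / \<phi> n\<close>. So
    \<open>s\<close> is almost invariant.\<close>
  have states: "AE \<omega> in M. \<forall>i\<in>{1..b}. (\<lambda>n. s \<omega> n i) \<longlonglongrightarrow> \<pi> i"
    using pairs AE_space
  proof eventually_elim
    case (elim \<omega>)
    show ?case
    proof
      fix i assume i: "i \<in> {1..b}"
      show "(\<lambda>n. s \<omega> n i) \<longlonglongrightarrow> \<pi> i"
      proof (rule almost_invariant_tendsto_stationary[OF P assms(7) _ _ _ i])
        show "0 \<le> s \<omega> n i" for n i
          unfolding s_def state_count_def by (intro mult_nonneg_nonneg sum_nonneg) auto
        \<comment> \<open>For \<open>\<phi> n = 0\<close> all frequencies are 0, so total mass 1
          holds only eventually.\<close>
        have "\<forall>\<^sub>F n in sequentially. 1 \<le> \<phi> n"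
          using assms(2) by (simp add: filterlim_at_top)
        then show "\<forall>\<^sub>F n in sequentially. (\<Sum>i\<in>{1..b}. s \<omega> n i) = 1"
        proof (rule eventually_mono)
          fix n assume "1 \<le> \<phi> n"
          then show "(\<Sum>i\<in>{1..b}. s \<omega> n i) = 1"
            using sum_state_count[OF elim(2), of "a n" "\<phi> n"]
            by (simp add: s_def flip: sum_divide_distrib)
        qed
        fix j assume j: "j \<in> {1..b}"
        have "(\<lambda>n. s \<omega> n j - (\<Sum>i\<in>{1..b}. t \<omega> n i j)) \<longlonglongrightarrow> 0"
        proof (rule Lim_null_comparison[OF always_eventually], rule allI)
          show "(\<lambda>n. 1 / real (\<phi> n)) \<longlonglongrightarrow> 0"
            by (rule filterlim_compose[OF lim_1_over_n assms(2)])
          fix n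
          have "s \<omega> n j - (\<Sum>i\<in>{1..b}. t \<omega> n i j) = 1 / real (\<phi> n) *
             (state_count \<xi> (a n) (\<phi> n) j \<omega> - (\<Sum>i\<in>{1..b}. pair_count \<xi> (a n) (\<phi> n) i j \<omega>))"
            by (simp add: s_def t_def right_diff_distrib sum_distrib_left)
          then show "norm (s \<omega> n j - (\<Sum>i\<in>{1..b}. t \<omega> n i j)) \<le> 1 / real (\<phi> n)"
            using mult_left_mono[OF state_count_diff_pair_count[OF elim(2), of "a n" "\<phi> n" j], of "1 / real (\<phi> n)"]
            by (simp add: abs_mult)
        qed
        moreover have "(\<lambda>n. \<Sum>i\<in>{1..b}. t \<omega> n i j - s \<omega> n i * P i j) \<longlonglongrightarrow> 0"
          using elim(1) j by (intro tendsto_null_sum) auto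
        ultimately have "(\<lambda>n. (s \<omega> n j - (\<Sum>i\<in>{1..b}. t \<omega> n i j))
            + (\<Sum>i\<in>{1..b}. t \<omega> n i j - s \<omega> n i * P i j)) \<longlonglongrightarrow> 0"
          by (rule tendsto_add_zero)
        then show "(\<lambda>n. s \<omega> n j - (\<Sum>i\<in>{1..b}. s \<omega> n i * P i j)) \<longlonglongrightarrow> 0"
          by (simp add: sum_subtractf)
      qed
    qed
  qed
  have part2: "AE \<omega> in M. (\<lambda>n. t \<omega> n i j) \<longlonglongrightarrow> \<pi> i * P i j"
    if i: "i \<in> {1..b}" and j: "j \<in> {1..b}" for i j
    using pair[OF i j] states
  proof eventually_elim
    case (elim \<omega>)
    then have "(\<lambda>n. s \<omega> n i * P i j) \<longlonglongrightarrow> \<pi> i * P i j"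
      using i by (intro tendsto_mult_right) auto
    from tendsto_add[OF elim(1) this] show ?case by simp
  qed
  define G where "G = (\<lambda>i. \<Sum>j\<in>{1..b}. P i j * ln (P i j))"
  have logs: "AE \<omega> in M. (\<lambda>n. 1 / real (\<phi> n) *
      (\<Sum>k\<in>{a n + 1..a n + \<phi> n}. ln (p k (\<xi> (k - 1) \<omega>) (\<xi> k \<omega>)))
     - (\<Sum>i\<in>{1..b}. 1 / real (\<phi> n) * state_count \<xi> (a n) (\<phi> n) i \<omega> * G i)) \<longlonglongrightarrow> 0"
  \<comment> \<open>Each of the \<open>b\<close> terms \<open>p * exp \<bar>ln p\<bar>\<close> is 1
    for \<open>0 < p \<le> 1\<close> and 0 for \<open>p = 0\<close>; the extra 1 makes
    \<open>K\<close> visibly positive.\<close>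
  proof (rule AE_average_tendsto_0[where K = "1 + real b" and g = "\<lambda>k i j. ln (p k i j)"])
    fix k i :: nat assume k: "1 \<le> k" and i: "i \<in> {1..b}"
    have "p k i j * exp \<bar>ln (p k i j)\<bar> \<le> 1" if "j \<in> {1..b}" for j
      using p0[OF k i that] p1[OF k i that]
      by (cases "p k i j = 0") (auto simp: abs_of_nonpos exp_minus)
    then have "(\<Sum>j\<in>{1..b}. p k i j * exp \<bar>ln (p k i j)\<bar>) \<le> (\<Sum>j\<in>{1..b}. 1)"
      by (rule sum_mono)
    then show "(\<Sum>j\<in>{1..b}. p k i j * exp \<bar>ln (p k i j)\<bar>) \<le> 1 + real b" by simp
  next
    fix i assume i: "i \<in> {1..b}"
    let ?I = "\<lambda>n. {a n + 1..a n + \<phi> n}"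
    show "(\<lambda>n. 1 / real (\<phi> n) *
      (\<Sum>k\<in>?I n. \<bar>(\<Sum>j\<in>{1..b}. p k i j * ln (p k i j)) - G i\<bar>)) \<longlonglongrightarrow> 0"
    proof (rule Lim_null_comparison[OF always_eventually], rule allI)
      show "(\<lambda>n. \<Sum>j\<in>{1..b}. 1 / real (\<phi> n) *
          (\<Sum>k\<in>?I n. \<bar>p k i j * ln (p k i j) - P i j * ln (P i j)\<bar>)) \<longlonglongrightarrow> 0"
      proof (rule tendsto_null_sum)
        fix j assume j: "j \<in> {1..b}"
        show "(\<lambda>n. 1 / real (\<phi> n) *
          (\<Sum>k\<in>?I n. \<bar>p k i j * ln (p k i j) - P i j * ln (P i j)\<bar>)) \<longlonglongrightarrow> 0"
          using p0[OF _ i j] p1[OF _ i j]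
          by (intro window_average_continuous[OF continuous_on_mult_ln P01[OF i j] _ p_lim[OF i j]]) auto
      qed
      fix n
      have "(\<Sum>k\<in>?I n. \<bar>(\<Sum>j\<in>{1..b}. p k i j * ln (p k i j)) - G i\<bar>)
          \<le> (\<Sum>k\<in>?I n. \<Sum>j\<in>{1..b}. \<bar>p k i j * ln (p k i j) - P i j * ln (P i j)\<bar>)"
        unfolding G_def sum_subtractf[symmetric] by (intro sum_mono sum_abs)
      also have "\<dots> = (\<Sum>j\<in>{1..b}. \<Sum>k\<in>?I n. \<bar>p k i j * ln (p k i j) - P i j * ln (P i j)\<bar>)"
        by (rule sum.swap)
      finally show "norm (1 / real (\<phi> n) * (\<Sum>k\<in>?I n. \<bar>(\<Sum>j\<in>{1..b}. p k i j * ln (p k i j)) - G i\<bar>))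
        \<le> (\<Sum>j\<in>{1..b}. 1 / real (\<phi> n) * (\<Sum>k\<in>?I n. \<bar>p k i j * ln (p k i j) - P i j * ln (P i j)\<bar>))"
        unfolding sum_distrib_left[symmetric] real_norm_def abs_mult
        by (intro mult_mono) auto
    qed
  qed (use summable in auto)
  have initial: "AE \<omega> in M.
      (\<lambda>n. 1 / real (\<phi> n) * ln \<P>(\<omega>' in M. \<xi> (a n) \<omega>' = \<xi> (a n) \<omega>)) \<longlonglongrightarrow> 0"
    by (rule AE_log_initial_tendsto_0) (rule summable)
  have part3: "AE \<omega> in M. (\<lambda>n. segment_entropy_density M \<xi> p (a n) (\<phi> n) \<omega>)
      \<longlonglongrightarrow> - (\<Sum>i\<in>{1..b}. \<Sum>j\<in>{1..b}. \<pi> i * P i j * ln (P i j))"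
    using logs states initial
  proof eventually_elim
    case (elim \<omega>)
    \<comment> \<open>The entropy density is minus the sum of the initial term, the log average
      centered at this frequency sum, and the frequency sum itself; the first two vanish in the
      limit.\<close>
    have "(\<lambda>n. \<Sum>i\<in>{1..b}. s \<omega> n i * G i) \<longlonglongrightarrow> (\<Sum>i\<in>{1..b}. \<pi> i * G i)"
      using elim(2) by (intro tendsto_intros) auto
    from tendsto_minus[OF tendsto_add[OF elim(3) tendsto_add[OF elim(1) this]]]
    have "(\<lambda>n. segment_entropy_density M \<xi> p (a n) (\<phi> n) \<omega>) \<longlonglongrightarrow> - (\<Sum>i\<in>{1..b}. \<pi> i * G i)"
      by (simp add: segment_entropy_density_def s_def add_divide_distrib diff_divide_distrib)
    then show ?case by (simp add: G_def sum_distrib_left mult.assoc)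
  qed
  show ?thesis
    using states part2 part3 unfolding s_def t_def by (auto elim: eventually_mono)
qed

end
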